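(* For every integer $n \geq 1$, the Golden derivative (with respect to $x$) of the Bernoulli-Fibonacci polynomial $B_n^F(x)$ satisfies $$D_F^x\left(B_n^F(x)\right) = F_n\, B_{n-1}^F(x).$$
   Context: Let $\varphi = \frac{1+\sqrt5}{2}$ and $\varphi' = \frac{1-\sqrt5}{2} = -\frac1\varphi$. The Fibonacci numbers are $F_n = \frac{\varphi^n - \varphi'^n}{\varphi-\varphi'}$ (so $F_0=0$, $F_1=F_2=1$, $F_3=2$, ...). The Fibonacci factorial is $F_n! = F_1F_2\cdots F_n$ for $n\ge 1$, with $F_0! = 1$. The Golden derivative of a function $f$ is $$D_F^x f(x) = \frac{f(\varphi x) - f(-\frac{x}{\varphi})}{\left(\varphi+\frac1\varphi\right)x},$$ where for a polynomial $f$ the right-hand side is a polynomial in $x$ (defined at $x=0$ by its polynomial value). The Golden exponential function is $e_F^x = \sum_{n=0}^\infty \frac{x^n}{F_n!}$ (written $e_F^{zx}$ when evaluated at $zx$). The Bernoulli-Fibonacci polynomials $B_n^F(x)$, $n\geq 0$, are defined by the generating function (power series in $z$) $$\frac{z\, e_F^{zx}}{e_F^{z}-1} = \sum_{n=0}^\infty B_n^F(x)\frac{z^n}{F_n!}.$$ *)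

theory Defs
  imports
    Complex_Main
    "HOL-Number_Theory.Fib"
    "HOL-Computational_Algebra.Polynomial"
    "HOL-Computational_Algebra.Formal_Power_Series"
begin

definition golden_ratio :: real where
  "golden_ratio = (1 + sqrt 5) / 2"

definition golden_ratio_conj :: real where
  "golden_ratio_conj = (1 - sqrt 5) / 2"

lemma golden_ratio_pos: "golden_ratio > 0"
  by (simp add: golden_ratio_def add_pos_nonneg)

lemma golden_ratio_conj_eq: "golden_ratio_conj = - (1 / golden_ratio)"
proof -
  have "golden_ratio_conj * golden_ratio = - 1"
    by (simp add: golden_ratio_def golden_ratio_conj_def algebra_simps)
  then show ?thesis
    using golden_ratio_pos by (simp add: field_simps)
qed

lemma fib_binet:
  "real (fib n) =
     (golden_ratio ^ n - golden_ratio_conj ^ n) / (golden_ratio - golden_ratio_conj)"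
  using fib_closed_form[of n]
  by (simp add: golden_ratio_def golden_ratio_conj_def field_simps)

definition fib_fact :: "nat \<Rightarrow> nat" where
  "fib_fact n = (\<Prod>k = 1..n. fib k)"

lemma fib_fact_pos: "fib_fact n > 0"
  unfolding fib_fact_def by (intro prod_pos) (auto intro: fib_neq_0_nat)

text \<open>At \<open>x = 0\<close> the quotient below is a division by zero and carries no information;
  the derivative of a polynomial is obtained by extending the quotient from \<open>x \<noteq> 0\<close>
  to a polynomial.\<close>

definition golden_quotient :: "(real \<Rightarrow> real) \<Rightarrow> real \<Rightarrow> real" where
  "golden_quotient f x =
     (f (golden_ratio * x) - f (- x / golden_ratio)) / ((golden_ratio + 1 / golden_ratio) * x)"

definition golden_deriv :: "real poly \<Rightarrow> real poly" where
  "golden_deriv p = (THE q. \<forall>x. x \<noteq> 0 \<longrightarrow> poly q x = golden_quotient (poly p) x)"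

lemma golden_deriv_ex1:
  "\<exists>!q. \<forall>x. x \<noteq> 0 \<longrightarrow> poly q x = golden_quotient (poly p) x"
proof (rule ex_ex1I)
  let ?c = "golden_ratio + 1 / golden_ratio"
  let ?d = "pcompose p [:0, golden_ratio:] - pcompose p [:0, - (1 / golden_ratio):]"
  have c: "?c > 0"
    using golden_ratio_pos by (simp add: add_pos_pos)
  have "poly ?d 0 = 0"
    by (simp add: poly_pcompose)
  then have "[:0, 1:] dvd ?d"
    using poly_eq_0_iff_dvd[of ?d 0] by simp
  then obtain r where r: "?d = [:0, 1:] * r" ..
  have "poly (smult (1 / ?c) r) x = golden_quotient (poly p) x" if "x \<noteq> 0" for x
  proof -
    have "poly p (golden_ratio * x) - poly p (- x / golden_ratio) = x * poly r x"
      using arg_cong[OF r, of "\<lambda>q. poly q x"] by (simp add: poly_pcompose mult.commute)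
    then show ?thesis
      using that c by (simp add: golden_quotient_def)
  qed
  then show "\<exists>q. \<forall>x. x \<noteq> 0 \<longrightarrow> poly q x = golden_quotient (poly p) x"
    by blast
next
  fix q r :: "real poly"
  assume q: "\<forall>x. x \<noteq> 0 \<longrightarrow> poly q x = golden_quotient (poly p) x"
    and r: "\<forall>x. x \<noteq> 0 \<longrightarrow> poly r x = golden_quotient (poly p) x"
  have "- {0} \<subseteq> {x. poly (q - r) x = 0}"
    using q r by auto
  moreover have "infinite (- {0 :: real})"
    by (simp add: Compl_eq_Diff_UNIV infinite_UNIV_char_0)
  ultimately show "q = r"
    using poly_roots_finite[of "q - r"] finite_subset by fastforce
qed

lemma poly_golden_deriv:
  "x \<noteq> 0 \<Longrightarrow> poly (golden_deriv p) x = golden_quotient (poly p) x"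
  using theI'[OF golden_deriv_ex1[of p]] unfolding golden_deriv_def by blast

text \<open>The Golden exponential \<open>e\<^sub>F\<close> evaluated at \<open>c z\<close>, as a formal power series in \<open>z\<close>.\<close>

definition golden_exp_fps :: "real \<Rightarrow> real fps" where
  "golden_exp_fps c = Abs_fps (\<lambda>n. c ^ n / real (fib_fact n))"

text \<open>Division of power series truncates in general; here it is exact, since the numerator
  also has no constant term (see \<open>bernoulli_fib_gf_mult\<close>).\<close>

definition bernoulli_fib :: "nat \<Rightarrow> real poly" where
  "bernoulli_fib = (THE B. \<forall>x.
     fps_X * golden_exp_fps x / (golden_exp_fps 1 - 1)
       = Abs_fps (\<lambda>n. poly (B n) x / real (fib_fact n)))"

lemma bernoulli_fib_ex1:
  "\<exists>!B :: nat \<Rightarrow> real poly. \<forall>x.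
     fps_X * golden_exp_fps x / (golden_exp_fps 1 - 1)
       = Abs_fps (\<lambda>n. poly (B n) x / real (fib_fact n))"
proof (rule ex_ex1I)
  let ?g = "golden_exp_fps 1 - 1"
  have g1: "fps_nth ?g 1 \<noteq> 0"
    by (simp add: golden_exp_fps_def fib_fact_def)
  have sub: "subdegree ?g \<le> subdegree (fps_X :: real fps)"
    using subdegree_leI[OF g1] by simp
  define G where "G = fps_X / ?g"
  define B where "B n =
    (\<Sum>k\<le>n. monom (real (fib_fact n) * fps_nth G (n - k) / real (fib_fact k)) k)" for n
  have nz: "fib_fact n \<noteq> 0" for n
    using fib_fact_pos[of n] by simp
  have "fps_X * golden_exp_fps x / ?g = Abs_fps (\<lambda>n. poly (B n) x / real (fib_fact n))" for x
  proof -
    have "fps_X * golden_exp_fps x / ?g = golden_exp_fps x * G"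
      unfolding G_def using fps_divide_times[OF sub, of "golden_exp_fps x"]
      by (simp only: mult.commute[of fps_X])
    also have "\<dots> = Abs_fps (\<lambda>n. poly (B n) x / real (fib_fact n))"
      by (rule fps_ext)
        (simp add: fps_mult_nth golden_exp_fps_def B_def poly_sum poly_monom
          sum_divide_distrib nz atLeast0AtMost mult.commute[of _ "x ^ _"])
    finally show ?thesis .
  qed
  then show "\<exists>B :: nat \<Rightarrow> real poly. \<forall>x.
      fps_X * golden_exp_fps x / ?g = Abs_fps (\<lambda>n. poly (B n) x / real (fib_fact n))"
    by blast
next
  fix B C :: "nat \<Rightarrow> real poly"
  assume B: "\<forall>x. fps_X * golden_exp_fps x / (golden_exp_fps 1 - 1)
      = Abs_fps (\<lambda>n. poly (B n) x / real (fib_fact n))"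
    and C: "\<forall>x. fps_X * golden_exp_fps x / (golden_exp_fps 1 - 1)
      = Abs_fps (\<lambda>n. poly (C n) x / real (fib_fact n))"
  have "poly (B n) x = poly (C n) x" for n x
  proof -
    have "fps_nth (Abs_fps (\<lambda>n. poly (B n) x / real (fib_fact n))) n
        = fps_nth (Abs_fps (\<lambda>n. poly (C n) x / real (fib_fact n))) n"
      using B C by metis
    then show ?thesis
      using fib_fact_pos[of n] by simp
  qed
  then show "B = C"
    by (intro ext) (simp flip: poly_eq_poly_eq_iff add: fun_eq_iff)
qed

lemma bernoulli_fib_gf:
  "fps_X * golden_exp_fps x / (golden_exp_fps 1 - 1)
     = Abs_fps (\<lambda>n. poly (bernoulli_fib n) x / real (fib_fact n))"
  using theI'[OF bernoulli_fib_ex1] unfolding bernoulli_fib_def by blast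

lemma bernoulli_fib_gf_mult:
  "Abs_fps (\<lambda>n. poly (bernoulli_fib n) x / real (fib_fact n)) * (golden_exp_fps 1 - 1)
     = fps_X * golden_exp_fps x"
proof -
  have g1: "fps_nth (golden_exp_fps 1 - 1) 1 \<noteq> 0"
    by (simp add: golden_exp_fps_def fib_fact_def)
  have nz: "golden_exp_fps 1 - 1 \<noteq> 0"
    using g1 by (metis fps_zero_nth)
  have x1: "fps_nth (golden_exp_fps x) 0 \<noteq> 0"
    by (simp add: golden_exp_fps_def fib_fact_def)
  have "subdegree (fps_X * golden_exp_fps x) = 1"
    by (rule subdegreeI) (use x1 in simp_all)
  then have "subdegree (golden_exp_fps 1 - 1) \<le> subdegree (fps_X * golden_exp_fps x)"
    using subdegree_leI[OF g1] by simp
  from fps_times_divide_eq[OF nz this] show ?thesis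
    unfolding bernoulli_fib_gf .
qed

end

theory Submission
  imports Defs
begin

text \<open>
  The golden derivative is the difference quotient between the points \<open>\<phi> x\<close> and \<open>\<phi>' x\<close>, so it acts
  on \<open>x\<^sup>n\<close> as multiplication by \<open>(\<phi>\<^sup>n - \<phi>'\<^sup>n) / ((\<phi> - \<phi>') x)\<close>, which is \<open>F\<^sub>n / x\<close> by Binet's formula.
  As \<open>F\<^sub>n! = F\<^sub>n F\<^sub>n\<^sub>-\<^sub>1!\<close>, the golden exponential \<open>e\<^sub>F\<^bsup>zx\<^esup>\<close> is therefore an eigenfunction with
  eigenvalue \<open>z\<close>. The generating function of the Bernoulli-Fibonacci polynomials is \<open>e\<^sub>F\<^bsup>zx\<^esup>\<close> times
  a factor that does not depend on \<open>x\<close>, hence it is an eigenfunction with eigenvalue \<open>z\<close> too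
  (\<open>bernoulli_fib_gf_difference\<close>), and the recurrence is the coefficient of \<open>z\<^sup>n\<close> in that identity.
  Working at a fixed \<open>x\<close> and clearing the denominator keeps all of this inside the ring of power
  series in \<open>z\<close>.
\<close>

lemma fib_fact_Suc: "fib_fact (Suc n) = fib (Suc n) * fib_fact n"
  by (simp add: fib_fact_def)

lemma golden_ratio_diff_pos: "golden_ratio - golden_ratio_conj > 0"
  by (simp add: golden_ratio_def golden_ratio_conj_def field_simps)

lemma golden_quotient_conj:
  "golden_quotient f x =
     (f (golden_ratio * x) - f (golden_ratio_conj * x)) / ((golden_ratio - golden_ratio_conj) * x)"
  by (simp add: golden_quotient_def golden_ratio_conj_eq)

text \<open>The eigenfunction property of the golden exponential, multiplied by \<open>(\<phi> - \<phi>') x\<close>.\<close>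

lemma golden_exp_fps_difference:
  "golden_exp_fps (golden_ratio * x) - golden_exp_fps (golden_ratio_conj * x) =
     fps_const ((golden_ratio - golden_ratio_conj) * x) * (fps_X * golden_exp_fps x)"
proof (rule fps_ext)
  fix n
  show "fps_nth (golden_exp_fps (golden_ratio * x) - golden_exp_fps (golden_ratio_conj * x)) n =
    fps_nth (fps_const ((golden_ratio - golden_ratio_conj) * x) * (fps_X * golden_exp_fps x)) n"
  proof (cases n)
    case 0
    then show ?thesis by (simp add: golden_exp_fps_def)
  next
    case (Suc m)
    let ?d = "golden_ratio - golden_ratio_conj"
    have binet: "golden_ratio ^ Suc m - golden_ratio_conj ^ Suc m = ?d * real (fib (Suc m))"
      using fib_binet[of "Suc m"] golden_ratio_diff_pos by simp
    have "fib (Suc m) > 0"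
      by (simp add: fib_neq_0_nat)
    have "fps_nth (golden_exp_fps (golden_ratio * x) - golden_exp_fps (golden_ratio_conj * x)) n =
        (golden_ratio ^ Suc m - golden_ratio_conj ^ Suc m) * x ^ Suc m / real (fib_fact (Suc m))"
      unfolding Suc golden_exp_fps_def fps_sub_nth fps_nth_Abs_fps power_mult_distrib
      by (simp only: diff_divide_distrib left_diff_distrib)
    also have "\<dots> = ?d * x * (x ^ m / real (fib_fact m))"
      unfolding binet fib_fact_Suc using \<open>fib (Suc m) > 0\<close> by simp
    also have "\<dots> = fps_nth (fps_const (?d * x) * (fps_X * golden_exp_fps x)) n"
      by (simp add: Suc golden_exp_fps_def)
    finally show ?thesis .
  qed
qed

definition bernoulli_fib_fps :: "real \<Rightarrow> real fps" where
  "bernoulli_fib_fps x = Abs_fps (\<lambda>n. poly (bernoulli_fib n) x / real (fib_fact n))"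

text \<open>The relation for the golden exponential carries over to the generating function because
  \<open>e\<^sub>F\<^sup>z - 1\<close> is free of \<open>x\<close> and can be cancelled, power series over a field forming an integral
  domain.\<close>

lemma bernoulli_fib_gf_difference:
  "bernoulli_fib_fps (golden_ratio * x) - bernoulli_fib_fps (golden_ratio_conj * x) =
     fps_const ((golden_ratio - golden_ratio_conj) * x) * (fps_X * bernoulli_fib_fps x)"
proof -
  let ?g = "golden_exp_fps 1 - 1"
  let ?c = "fps_const ((golden_ratio - golden_ratio_conj) * x)"
  have gf: "bernoulli_fib_fps y * ?g = fps_X * golden_exp_fps y" for y
    unfolding bernoulli_fib_fps_def by (rule bernoulli_fib_gf_mult)
  have "fps_nth ?g 1 \<noteq> 0"
    by (simp add: golden_exp_fps_def fib_fact_def)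
  then have "?g \<noteq> 0"
    by (metis fps_zero_nth)
  moreover have "(bernoulli_fib_fps (golden_ratio * x) - bernoulli_fib_fps (golden_ratio_conj * x)) * ?g
      = (?c * (fps_X * bernoulli_fib_fps x)) * ?g"
  proof -
    have "(bernoulli_fib_fps (golden_ratio * x) - bernoulli_fib_fps (golden_ratio_conj * x)) * ?g
        = fps_X * (golden_exp_fps (golden_ratio * x) - golden_exp_fps (golden_ratio_conj * x))"
      by (simp only: left_diff_distrib right_diff_distrib[of fps_X] gf)
    also have "\<dots> = ?c * (fps_X * (fps_X * golden_exp_fps x))"
      unfolding golden_exp_fps_difference by (simp only: mult.left_commute)
    also have "\<dots> = (?c * (fps_X * bernoulli_fib_fps x)) * ?g"
      by (simp only: gf[symmetric] mult.assoc)
    finally show ?thesis .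
  qed
  ultimately show ?thesis
    by (metis mult_right_cancel)
qed

lemma golden_quotient_bernoulli_fib:
  assumes "x \<noteq> 0"
  shows "golden_quotient (poly (bernoulli_fib (Suc m))) x =
    real (fib (Suc m)) * poly (bernoulli_fib m) x"
proof -
  let ?d = "golden_ratio - golden_ratio_conj"
  let ?\<Delta> = "poly (bernoulli_fib (Suc m)) (golden_ratio * x) -
    poly (bernoulli_fib (Suc m)) (golden_ratio_conj * x)"
  have pos: "fib (Suc m) > 0" "fib_fact m > 0"
    by (simp_all add: fib_neq_0_nat fib_fact_pos)
  have "?\<Delta> / real (fib_fact (Suc m)) = ?d * x * (poly (bernoulli_fib m) x / real (fib_fact m))"
    using arg_cong[OF bernoulli_fib_gf_difference[of x], of "\<lambda>f. fps_nth f (Suc m)"]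
    by (simp add: bernoulli_fib_fps_def diff_divide_distrib)
  then have "?\<Delta> = ?d * x * (real (fib (Suc m)) * poly (bernoulli_fib m) x)"
    unfolding fib_fact_Suc of_nat_mult using pos
    by (simp add: divide_eq_eq mult.assoc mult.left_commute mult.commute del: fib.simps)
  then show ?thesis
    using assms golden_ratio_diff_pos by (simp add: golden_quotient_conj del: fib.simps)
qed

theorem proposition4p0p2:
  fixes n :: nat
  assumes "n \<ge> 1"
  shows "golden_deriv (bernoulli_fib n) = smult (real (fib n)) (bernoulli_fib (n - 1))"
proof -
  obtain m where n: "n = Suc m"
    using assms by (cases n) auto
  have "\<forall>x. x \<noteq> 0 \<longrightarrow> poly (golden_deriv (bernoulli_fib n)) x
      = golden_quotient (poly (bernoulli_fib n)) x"
    using poly_golden_deriv by blast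
  moreover have "\<forall>x. x \<noteq> 0 \<longrightarrow> poly (smult (real (fib n)) (bernoulli_fib (n - 1))) x
      = golden_quotient (poly (bernoulli_fib n)) x"
    unfolding n by (simp add: golden_quotient_bernoulli_fib del: fib.simps)
  \<comment> \<open>A polynomial is determined by its values away from \<open>0\<close>.\<close>
  ultimately show ?thesis
    using golden_deriv_ex1[of "bernoulli_fib n"] by blast
qed

end
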